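(* Let $a\in\mathbb B\setminus\mathbb R$ and $I=\vec a/\|\vec a\|$, or let $a\in\mathbb B\cap\mathbb R$ and let $I$ be any element of $\mathbb S^2$. Then for any $f\in\mathcal B$ one has $f\circ_I T_a\in\mathcal B$.
   Context: $\mathbb H$ denotes the quaternions, $q=x_0+\vec q$ with real part $x_0$ and imaginary part $\vec q$; $\mathbb S^2$ is the sphere of purely imaginary unit quaternions. For $i\in\mathbb S^2$, $\mathbb C(i)=\{x+iy: x,y\in\mathbb R\}$. $\mathbb B$ is the open unit ball of $\mathbb H$ and $\mathbb B_i=\mathbb B\cap\mathbb C(i)$. A real differentiable function $f:\mathbb B\to\mathbb H$ is (left) slice regular if for every $i\in\mathbb S^2$, $\left(\frac{\partial}{\partial x}+i\frac{\partial}{\partial y}\right)f(x+iy)=0$ on $\mathbb B_i$; $\mathcal{SR}(\mathbb B)$ is the set of these functions. $\mathcal B$ (the slice regular Bloch space) is the set of $f\in\mathcal{SR}(\mathbb B)$ with $\sup_{q\in\mathbb B}(1-|q|^2)\left|\frac{\partial f}{\partial x_0}(q)\right|<\infty$. $Q_I[f]=f|_{\mathbb B_I}$. For $j\in\mathbb S^2$ orthogonal to $I$, every $f\in\mathcal{SR}(\mathbb B)$ satisfies $Q_I[f]=f_1+f_2j$ with $f_1,f_2:\mathbb B_I\to\mathbb C(I)$ holomorphic. For $g=g_1+g_2j$ with $g_1,g_2:\mathbb B_I\to\mathbb C(I)$ holomorphic, $P_I[g]\in\mathcal{SR}(\mathbb B)$ is the slice regular extension $$P_I[g](x+I_qy)=\tfrac12\left[(1+I_qI)g(x-yI)+(1-I_qI)g(x+yI)\right].$$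 The slice regular Möbius transformation is $T_a(q)=(1-q\bar a)^{-\ast}\ast(a-q)$, $q\in\mathbb B$, where $\ast$ is the slice regular product (for power series, $\left(\sum q^na_n\right)\ast\left(\sum q^nb_n\right)=\sum_n q^n\sum_{k}a_kb_{n-k}$) and $(1-q\bar a)^{-\ast}=\sum_{n\ge0}q^n\bar a^n$; on $\mathbb B_I$ it equals $T_a(z)=\frac{a-z}{1-\bar az}$. The composition is $f\circ_IT_a:=P_I[f_1\circ Q_I[T_a]]+P_I[f_2\circ Q_I[T_a]]\,j\in\mathcal{SR}(\mathbb B)$, where $j\in\mathbb S^2$ is orthogonal to $I$ and $f_1,f_2:\mathbb B_I\to\mathbb C(I)$ are the holomorphic functions such that $Q_I[f]=f_1+f_2j$. *)

theory Defs
  imports "HOL-Analysis.Analysis"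
begin

section \<open>Quaternions\<close>

codatatype quat = Quat (qRe: real) (qIm1: real) (qIm2: real) (qIm3: real)

lemma quat_eq_iff:
  "p = q \<longleftrightarrow> qRe p = qRe q \<and> qIm1 p = qIm1 q \<and> qIm2 p = qIm2 q \<and> qIm3 p = qIm3 q"
  by (auto intro: quat.expand)

instantiation quat :: real_vector
begin

primcorec zero_quat where
  "qRe 0 = 0" | "qIm1 0 = 0" | "qIm2 0 = 0" | "qIm3 0 = 0"

primcorec plus_quat where
  "qRe (p + q) = qRe p + qRe q"
| "qIm1 (p + q) = qIm1 p + qIm1 q"
| "qIm2 (p + q) = qIm2 p + qIm2 q"
| "qIm3 (p + q) = qIm3 p + qIm3 q"

primcorec uminus_quat where
  "qRe (- q) = - qRe q" | "qIm1 (- q) = - qIm1 q" | "qIm2 (- q) = - qIm2 q" | "qIm3 (- q) = - qIm3 q"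

primcorec minus_quat where
  "qRe (p - q) = qRe p - qRe q"
| "qIm1 (p - q) = qIm1 p - qIm1 q"
| "qIm2 (p - q) = qIm2 p - qIm2 q"
| "qIm3 (p - q) = qIm3 p - qIm3 q"

primcorec scaleR_quat where
  "qRe (r *\<^sub>R q) = r * qRe q"
| "qIm1 (r *\<^sub>R q) = r * qIm1 q"
| "qIm2 (r *\<^sub>R q) = r * qIm2 q"
| "qIm3 (r *\<^sub>R q) = r * qIm3 q"

instance
  by standard (simp_all add: quat_eq_iff algebra_simps)

end

text \<open>Hamilton's product for the basis \<open>1, i, j, k\<close> with \<open>i j = k\<close>.\<close>

instantiation quat :: real_algebra_1
begin

primcorec one_quat where
  "qRe 1 = 1" | "qIm1 1 = 0" | "qIm2 1 = 0" | "qIm3 1 = 0"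

primcorec times_quat where
  "qRe (p * q) = qRe p * qRe q - qIm1 p * qIm1 q - qIm2 p * qIm2 q - qIm3 p * qIm3 q"
| "qIm1 (p * q) = qRe p * qIm1 q + qIm1 p * qRe q + qIm2 p * qIm3 q - qIm3 p * qIm2 q"
| "qIm2 (p * q) = qRe p * qIm2 q - qIm1 p * qIm3 q + qIm2 p * qRe q + qIm3 p * qIm1 q"
| "qIm3 (p * q) = qRe p * qIm3 q + qIm1 p * qIm2 q - qIm2 p * qIm1 q + qIm3 p * qRe q"

instance
  by standard (simp_all add: quat_eq_iff algebra_simps)

end

instantiation quat :: real_inner
begin

definition inner_quat :: "quat \<Rightarrow> quat \<Rightarrow> real" where
  "inner_quat p q = qRe p * qRe q + qIm1 p * qIm1 q + qIm2 p * qIm2 q + qIm3 p * qIm3 q"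

definition norm_quat :: "quat \<Rightarrow> real" where
  "norm_quat q = sqrt ((qRe q)\<^sup>2 + (qIm1 q)\<^sup>2 + (qIm2 q)\<^sup>2 + (qIm3 q)\<^sup>2)"

definition sgn_quat :: "quat \<Rightarrow> quat" where
  "sgn_quat q = q /\<^sub>R norm q"

definition dist_quat :: "quat \<Rightarrow> quat \<Rightarrow> real" where
  "dist_quat p q = norm (p - q)"

definition uniformity_quat :: "(quat \<times> quat) filter" where
  "uniformity_quat = (INF e\<in>{0 <..}. principal {(x, y). dist x y < e})"

definition open_quat :: "quat set \<Rightarrow> bool" where
  "open_quat U \<longleftrightarrow> (\<forall>x\<in>U. eventually (\<lambda>(x', y). x' = x \<longrightarrow> y \<in> U) uniformity)"

instance
proof
  fix p q s :: quat and r :: real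
  show "inner p q = inner q p"
    by (simp add: inner_quat_def mult.commute)
  show "inner (p + q) s = inner p s + inner q s"
    by (simp add: inner_quat_def algebra_simps)
  show "inner (r *\<^sub>R p) q = r * inner p q"
    by (simp add: inner_quat_def algebra_simps)
  show "0 \<le> inner p p"
    by (simp add: inner_quat_def)
  show "(inner p p = 0) = (p = 0)"
    by (auto simp: inner_quat_def quat_eq_iff add_nonneg_eq_0_iff)
  show "norm p = sqrt (inner p p)"
    by (simp add: inner_quat_def norm_quat_def power2_eq_square)
qed (rule sgn_quat_def dist_quat_def uniformity_quat_def open_quat_def)+

end

lemma norm_quat_power2:
  "(norm q)\<^sup>2 = (qRe q)\<^sup>2 + (qIm1 q)\<^sup>2 + (qIm2 q)\<^sup>2 + (qIm3 q)\<^sup>2"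
  by (simp add: norm_quat_def)

definition qcnj :: "quat \<Rightarrow> quat" where
  "qcnj q = Quat (qRe q) (- qIm1 q) (- qIm2 q) (- qIm3 q)"

lemma qcnj_sel [simp]:
  "qRe (qcnj q) = qRe q" "qIm1 (qcnj q) = - qIm1 q" "qIm2 (qcnj q) = - qIm2 q" "qIm3 (qcnj q) = - qIm3 q"
  by (simp_all add: qcnj_def)

instantiation quat :: real_normed_div_algebra
begin

definition inverse_quat :: "quat \<Rightarrow> quat" where
  "inverse_quat q = qcnj q /\<^sub>R (norm q)\<^sup>2"

definition divide_quat :: "quat \<Rightarrow> quat \<Rightarrow> quat" where
  "divide_quat p q = p * inverse q"

lemma quat_mult_qcnj: "q * qcnj q = of_real ((norm q)\<^sup>2)" "qcnj q * q = of_real ((norm q)\<^sup>2)"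
  by (simp_all add: quat_eq_iff norm_quat_power2 of_real_def del: of_real_power)
    (simp_all add: power2_eq_square)

instance
proof
  fix p q :: quat
  show "p \<noteq> 0 \<Longrightarrow> inverse p * p = 1"
    by (simp add: inverse_quat_def quat_mult_qcnj of_real_def)
  show "p \<noteq> 0 \<Longrightarrow> p * inverse p = 1"
    by (simp add: inverse_quat_def quat_mult_qcnj of_real_def)
  show "p div q = p * inverse q"
    by (simp add: divide_quat_def)
  show "inverse (0::quat) = 0"
    by (simp add: inverse_quat_def quat_eq_iff)
  show "norm (p * q) = norm p * norm q"
    unfolding norm_quat_def real_sqrt_mult [symmetric] times_quat.sel
    by (rule arg_cong [where f = sqrt]) algebra
qed

end

instantiation quat :: euclidean_space
begin

definition Basis_quat :: "quat set" where
  "Basis_quat = {Quat 1 0 0 0, Quat 0 1 0 0, Quat 0 0 1 0, Quat 0 0 0 1}"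

instance
proof
  show "(Basis :: quat set) \<noteq> {}" "finite (Basis :: quat set)"
    by (simp_all add: Basis_quat_def)
next
  fix u v :: quat
  assume "u \<in> Basis" "v \<in> Basis"
  then show "inner u v = (if u = v then 1 else 0)"
    unfolding Basis_quat_def by (elim insertE emptyE; simp add: inner_quat_def)
next
  fix x :: quat
  show "(\<forall>u\<in>Basis. inner x u = 0) \<longleftrightarrow> x = 0"
    unfolding Basis_quat_def by (simp add: inner_quat_def) (simp add: quat_eq_iff)
qed

end

lemma quat_of_real_sel [simp]:
  "qRe (of_real x) = x" "qIm1 (of_real x) = 0" "qIm2 (of_real x) = 0" "qIm3 (of_real x) = 0"
  by (simp_all add: of_real_def)

text \<open>The imaginary part of \<open>q\<close>, as a quaternion.\<close>

definition qvec :: "quat \<Rightarrow> quat" where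
  "qvec q = q - of_real (qRe q)"

lemma qvec_sel [simp]:
  "qRe (qvec q) = 0" "qIm1 (qvec q) = qIm1 q" "qIm2 (qvec q) = qIm2 q" "qIm3 (qvec q) = qIm3 q"
  by (simp_all add: qvec_def)


section \<open>Slices\<close>

definition imag_sphere :: "quat set" where
  "imag_sphere = {q. qRe q = 0 \<and> norm q = 1}"

definition slice_plane :: "quat \<Rightarrow> quat set" where
  "slice_plane i = {of_real x + i * of_real y | x y. True}"

definition slice_ball :: "quat \<Rightarrow> quat set" where
  "slice_ball i = ball 0 1 \<inter> slice_plane i"

text \<open>For \<open>i\<close> in the imaginary sphere this is the isometric field isomorphism from the
  complex numbers onto the slice plane of \<open>i\<close>; it maps the unit disc onto the slice ball.\<close>

definition slice_embed :: "quat \<Rightarrow> complex \<Rightarrow> quat" where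
  "slice_embed i z = of_real (Re z) + i * of_real (Im z)"

text \<open>Holomorphic functions from the slice ball of \<open>i\<close> to the slice plane of \<open>i\<close>.\<close>

definition slice_holomorphic :: "quat \<Rightarrow> (quat \<Rightarrow> quat) \<Rightarrow> bool" where
  "slice_holomorphic i g \<longleftrightarrow>
    (\<exists>h. h holomorphic_on ball 0 1 \<and> (\<forall>z\<in>ball 0 1. g (slice_embed i z) = slice_embed i (h z)))"


section \<open>Slice regular functions and the Bloch space\<close>

text \<open>Functions on the unit ball \<^term>\<open>ball 0 1 :: quat set\<close> are total functions of which only
  the values on the ball matter.\<close>

definition slice_regular :: "(quat \<Rightarrow> quat) set" where
  "slice_regular = {f. f differentiable_on ball 0 1 \<and>
    (\<forall>i\<in>imag_sphere. \<forall>x y. of_real x + i * of_real y \<in> ball 0 1 \<longrightarrow>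
      vector_derivative (\<lambda>s. f (of_real s + i * of_real y)) (at x) +
      i * vector_derivative (\<lambda>t. f (of_real x + i * of_real t)) (at y) = 0)}"

definition deriv_x0 :: "(quat \<Rightarrow> quat) \<Rightarrow> quat \<Rightarrow> quat" where
  "deriv_x0 f q = vector_derivative (\<lambda>t. f (q + of_real t)) (at 0)"

definition slice_bloch :: "(quat \<Rightarrow> quat) set" where
  "slice_bloch = {f \<in> slice_regular.
    bdd_above ((\<lambda>q. (1 - (norm q)\<^sup>2) * norm (deriv_x0 f q)) ` ball 0 1)}"

definition slice_restrict :: "quat \<Rightarrow> (quat \<Rightarrow> quat) \<Rightarrow> quat \<Rightarrow> quat" where
  "slice_restrict I f = restrict f (slice_ball I)"

text \<open>The extension operator \<open>P\<^sub>I\<close>. Here \<open>sgn (qvec q)\<close> is the imaginary unit \<open>I\<^sub>q\<close> of a non-real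
  \<open>q\<close>. For real \<open>q\<close> any imaginary unit may serve as \<open>I\<^sub>q\<close>, since then \<open>y = 0\<close> and the
  terms with \<open>I\<^sub>q\<close> cancel; \<open>sgn 0 = 0\<close> gives the same value.\<close>

definition slice_extend :: "quat \<Rightarrow> (quat \<Rightarrow> quat) \<Rightarrow> quat \<Rightarrow> quat" where
  "slice_extend I g q =
    (let x = of_real (qRe q); y = of_real (norm (qvec q)); Iq = sgn (qvec q)
     in ((1 + Iq * I) * g (x - y * I) + (1 - Iq * I) * g (x + y * I)) /\<^sub>R 2)"

lemma slice_extend_eq:
  assumes "J \<in> imag_sphere"
  shows "slice_extend I g (of_real x + J * of_real y) =
    ((1 + J * I) * g (of_real x - of_real y * I) + (1 - J * I) * g (of_real x + of_real y * I)) /\<^sub>R 2"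
proof -
  have J: "qRe J = 0" "norm J = 1"
    using assms by (auto simp: imag_sphere_def)
  have v: "qvec (of_real x + J * of_real y) = y *\<^sub>R J" and r: "qRe (of_real x + J * of_real y) = x"
    using J by (simp_all add: quat_eq_iff)
  have n: "norm (y *\<^sub>R J) = \<bar>y\<bar>" and s: "sgn (y *\<^sub>R J) = sgn y *\<^sub>R J"
    using J by (simp_all add: sgn_scaleR sgn_div_norm)
  note e = slice_extend_def Let_def v r n s
  consider "y > 0" | "y = 0" | "y < 0" by linarith
  then show ?thesis
  proof cases
    case 1
    then show ?thesis
      unfolding e by simp
  next
    case 2
    then show ?thesis
      unfolding e by (simp add: distrib_right left_diff_distrib)
  next
    case 3
    then have "sgn y *\<^sub>R J = - J" "of_real \<bar>y\<bar> = - (of_real y :: quat)"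
      by simp_all
    then show ?thesis
      unfolding e by (simp add: add.commute)
  qed
qed


section \<open>Moebius transformations and composition\<close>

text \<open>Slice regular power series have their coefficients on the right. The slice regular product
  of two series is the Cauchy product of the coefficient sequences, that is, multiplication of formal
  power series over the (noncommutative) quaternions.\<close>

definition slice_eval :: "quat fps \<Rightarrow> quat \<Rightarrow> quat" where
  "slice_eval F q = (\<Sum>n. q ^ n * fps_nth F n)"

text \<open>The first factor is the series \<open>(1 - q a\<^sup>*)\<^sup>-\<^sup>*\<close> with coefficients the powers of the conjugate of
  \<open>a\<close>; the second is \<open>a - q\<close>.\<close>

definition slice_moebius :: "quat \<Rightarrow> quat \<Rightarrow> quat" where
  "slice_moebius a = slice_eval (Abs_fps (\<lambda>n. qcnj a ^ n) * (fps_const a - fps_X))"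

definition slice_splitting ::
  "quat \<Rightarrow> quat \<Rightarrow> (quat \<Rightarrow> quat) \<Rightarrow> (quat \<Rightarrow> quat) \<Rightarrow> (quat \<Rightarrow> quat) \<Rightarrow> bool" where
  "slice_splitting I j f f1 f2 \<longleftrightarrow> slice_holomorphic I f1 \<and> slice_holomorphic I f2 \<and>
    (\<forall>z\<in>slice_ball I. slice_restrict I f z = f1 z + f2 z * j)"

text \<open>\<open>f \<circ>\<^sub>I T\<close>, computed with the help of \<open>j\<close>. The components of \<open>f\<close> are determined on the slice
  ball by \<open>I\<close> and \<open>j\<close>, and their values elsewhere play no role when \<open>T\<close> maps the slice ball to itself.\<close>

definition slice_compose :: "quat \<Rightarrow> quat \<Rightarrow> (quat \<Rightarrow> quat) \<Rightarrow> (quat \<Rightarrow> quat) \<Rightarrow> quat \<Rightarrow> quat" where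
  "slice_compose I j f T =
    (let (f1, f2) = (SOME (f1, f2). slice_splitting I j f f1 f2)
     in (\<lambda>q. slice_extend I (f1 \<circ> slice_restrict I T) q + slice_extend I (f2 \<circ> slice_restrict I T) q * j))"

end

theory Submission
  imports Defs "HOL-Complex_Analysis.Complex_Analysis"
begin

text \<open>On the slice of \<open>I\<close> the Moebius map is the classical one, \<open>\<phi> z = (\<alpha> - z) / (1 - cnj \<alpha> z)\<close>, and
  \<open>f \<circ>\<^sub>I T\<^sub>a\<close> agrees there with \<open>f \<circ> \<phi>\<close>. By the Cauchy-Riemann equation its \<open>x\<^sub>0\<close>-derivative is \<open>\<phi>'\<close> times
  that of \<open>f\<close> at \<open>\<phi> z\<close>, so the equality \<open>(1 - |z|\<^sup>2) |\<phi>' z| = 1 - |\<phi> z|\<^sup>2\<close> bounds it on this slice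
  by the Bloch constant of \<open>f\<close>, and the representation formula carries the bound to all slices.
  Regularity of the extension, including differentiability across the real axis, is read off its
  power series with quaternionic coefficients.\<close>

section \<open>Slice planes\<close>

lemma imag_sphere_square:
  assumes "i \<in> imag_sphere"
  shows "i * i = -1"
proof -
  have "qRe i = 0" and "(qIm1 i)\<^sup>2 + (qIm2 i)\<^sup>2 + (qIm3 i)\<^sup>2 = 1"
    using assms norm_quat_power2[of i] by (auto simp: imag_sphere_def)
  then show ?thesis
    by (simp add: quat_eq_iff power2_eq_square)
qed

text \<open>The real part of a product of imaginary quaternions is minus their inner product. For
  orthogonal units only the cross product is left, and it is antisymmetric.\<close>

lemma imag_sphere_anticommute:
  assumes "i \<in> imag_sphere" "j \<in> imag_sphere" "orthogonal i j"
  shows "j * i = - (i * j)"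
  using assms by (simp add: imag_sphere_def orthogonal_def inner_quat_def quat_eq_iff algebra_simps)

lemma slice_embed_of_real [simp]: "slice_embed i (of_real x) = of_real x"
  by (simp add: slice_embed_def)

lemma slice_embed_one [simp]: "slice_embed i 1 = 1"
  by (simp add: slice_embed_def)

lemma slice_embed_add: "slice_embed i (z + w) = slice_embed i z + slice_embed i w"
  by (simp add: slice_embed_def algebra_simps)

lemma slice_embed_scaleR: "slice_embed i (r *\<^sub>R z) = r *\<^sub>R slice_embed i z"
  by (simp add: quat_eq_iff slice_embed_def algebra_simps)

lemma slice_embed_mult:
  assumes "i \<in> imag_sphere"
  shows "slice_embed i (z * w) = slice_embed i z * slice_embed i w"
proof -
  \<comment> \<open>Quaternions do not commute, so the normal form is arranged by hand: real factors
    move past \<open>i\<close> and past each other, and two adjacent \<open>i\<close> collapse to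
    -1.\<close>
  have "i * (i * p) = - p" for p
    using imag_sphere_square[OF assms] by (simp flip: mult.assoc)
  moreover have "of_real x * i = i * of_real x" for x
    by (simp add: quat_eq_iff)
  moreover have "of_real x * (i * q) = i * (of_real x * q)" for x q
    by (simp add: quat_eq_iff algebra_simps)
  moreover have "of_real x * of_real y = of_real y * (of_real x :: quat)" for x y
    by (simp flip: of_real_mult add: mult.commute)
  ultimately show ?thesis
    by (simp add: slice_embed_def algebra_simps)
qed

lemma slice_embed_power:
  assumes "i \<in> imag_sphere"
  shows "slice_embed i (z ^ n) = slice_embed i z ^ n"
  by (induction n) (simp_all add: slice_embed_mult[OF assms])

lemma norm_slice_embed:
  assumes "i \<in> imag_sphere"
  shows "norm (slice_embed i z) = norm z"
proof -
  have i: "qRe i = 0" "(qIm1 i)\<^sup>2 + (qIm2 i)\<^sup>2 + (qIm3 i)\<^sup>2 = 1"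
    using assms norm_quat_power2[of i] by (auto simp: imag_sphere_def)
  have "(norm (slice_embed i z))\<^sup>2 = (Re z)\<^sup>2 + (Im z)\<^sup>2 * ((qIm1 i)\<^sup>2 + (qIm2 i)\<^sup>2 + (qIm3 i)\<^sup>2)"
    by (simp add: norm_quat_power2 slice_embed_def i(1) algebra_simps)
  then have "(norm (slice_embed i z))\<^sup>2 = (norm z)\<^sup>2"
    by (simp add: i(2) cmod_power2)
  then show ?thesis
    by simp
qed

lemma bounded_linear_slice_embed:
  assumes "i \<in> imag_sphere"
  shows "bounded_linear (slice_embed i)"
  by (rule bounded_linear_intro[where K = 1])
    (simp_all add: slice_embed_add slice_embed_scaleR norm_slice_embed[OF assms])

lemma slice_embed_in_slice_ball:
  assumes "i \<in> imag_sphere" "norm z < 1"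
  shows "slice_embed i z \<in> slice_ball i"
  using norm_slice_embed[OF assms(1), of z] assms(2)
  by (auto simp: slice_ball_def slice_plane_def slice_embed_def)

lemma quat_in_slice_plane:
  obtains J z where "J \<in> imag_sphere" "q = slice_embed J z"
proof (cases "qvec q = 0")
  case True
  \<comment> \<open>A real \<open>q\<close> lies in every slice, so any imaginary unit
    serves.\<close>
  have "Quat 0 1 0 0 \<in> imag_sphere" "q = slice_embed (Quat 0 1 0 0) (of_real (qRe q))"
    using True by (auto simp: imag_sphere_def norm_quat_def qvec_def)
  then show ?thesis
    by (rule that)
next
  case False
  have "sgn (qvec q) \<in> imag_sphere"
    using False by (simp add: imag_sphere_def norm_sgn) (simp add: sgn_div_norm)
  moreover have "q = slice_embed (sgn (qvec q)) (Complex (qRe q) (norm (qvec q)))"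
    using False by (simp add: slice_embed_def quat_eq_iff sgn_div_norm)
  ultimately show ?thesis
    by (rule that)
qed


section \<open>Noncommutative power series\<close>

text \<open>The noncommutative derivative of the n-th power in direction \<open>h\<close>: the sum
  of \<open>q^k * h * q^(n-1-k)\<close> over k < n, generated by the product rule for
  \<open>q * q^n\<close>.\<close>

primrec power_deriv :: "nat \<Rightarrow> 'a::real_normed_algebra_1 \<Rightarrow> 'a \<Rightarrow> 'a" where
  "power_deriv 0 q h = 0"
| "power_deriv (Suc n) q h = h * q ^ n + q * power_deriv n q h"

lemma has_derivative_power_noncomm:
  fixes q :: "'a::real_normed_algebra_1"
  shows "((\<lambda>q. q ^ n) has_derivative power_deriv n q) (at q within S)"
proof (induction n)
  case (Suc n)
  have "((\<lambda>q. q * q ^ n) has_derivative (\<lambda>h. q * power_deriv n q h + h * q ^ n)) (at q within S)"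
    by (rule has_derivative_mult[OF has_derivative_ident Suc])
  then show ?case
    unfolding power_Suc by (rule has_derivative_eq_rhs) (auto simp: add.commute)
qed (auto intro!: has_derivative_eq_rhs[OF has_derivative_const])

lemma norm_power_deriv_le:
  assumes "norm q \<le> r"
  shows "norm (power_deriv n q h) \<le> of_nat n * r ^ (n - 1) * norm h"
proof (induction n)
  case (Suc n)
  have r: "0 \<le> r"
    using assms norm_ge_zero order_trans by blast
  have "norm (h * q ^ n) \<le> norm h * r ^ n"
    by (intro order_trans[OF norm_mult_ineq] mult_left_mono order_trans[OF norm_power_ineq] power_mono assms) auto
  moreover have "norm (q * power_deriv n q h) \<le> of_nat n * r ^ n * norm h"
  proof -
    have "norm (q * power_deriv n q h) \<le> r * (of_nat n * r ^ (n - 1) * norm h)"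
      by (intro order_trans[OF norm_mult_ineq] mult_mono assms Suc r) auto
    \<comment> \<open>The case n = 0, where \<open>n - 1\<close> truncates, is harmless because the
      factor \<open>of_nat n\<close> vanishes.\<close>
    also have "\<dots> = of_nat n * r ^ n * norm h"
      by (cases n) auto
    finally show ?thesis .
  qed
  moreover have "of_nat (Suc n) * r ^ n * norm h = norm h * r ^ n + of_nat n * r ^ n * norm h"
    by (simp add: algebra_simps)
  ultimately show ?case
    using norm_triangle_ineq[of "h * q ^ n" "q * power_deriv n q h"] by simp
qed auto

text \<open>If \<open>i\<close> commutes with \<open>q\<close>, it slides to the front of each
  summand \<open>q^k * i * q^(n-1-k)\<close>. This is the Cauchy-Riemann equation for
  powers.\<close>

lemma power_deriv_commute:
  assumes "i * q = q * i"
  shows "power_deriv n q i = i * power_deriv n q 1"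
proof (induction n)
  case (Suc n)
  have "q * (i * power_deriv n q 1) = i * (q * power_deriv n q 1)"
    using assms by (simp flip: mult.assoc)
  then show ?case
    by (simp add: Suc distrib_left)
qed auto

text \<open>Absolute convergence of the differentiated series on the unit ball. Only norms of
  coefficients enter, so the condition passes from complex to quaternionic coefficients and directly
  supplies majorants.\<close>

definition deriv_summable :: "(nat \<Rightarrow> 'a::real_normed_vector) \<Rightarrow> bool" where
  "deriv_summable C \<longleftrightarrow> (\<forall>r. 0 \<le> r \<longrightarrow> r < 1 \<longrightarrow> summable (\<lambda>n. of_nat n * r ^ (n - 1) * norm (C n)))"

lemma deriv_summable_power_deriv:
  fixes C :: "nat \<Rightarrow> 'a::{real_normed_algebra_1, banach}"
  assumes "deriv_summable C" "norm q < 1"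
  shows "summable (\<lambda>n. power_deriv n q h * C n)"
proof (rule summable_comparison_test')
  show "summable (\<lambda>n. (of_nat n * norm q ^ (n - 1) * norm (C n)) * norm h)"
    using assms by (intro summable_mult2) (auto simp: deriv_summable_def)
  show "norm (power_deriv n q h * C n) \<le> (of_nat n * norm q ^ (n - 1) * norm (C n)) * norm h" for n
    using mult_right_mono[OF norm_power_deriv_le[of q "norm q" n h], of "norm (C n)"]
    by (intro order_trans[OF norm_mult_ineq]) (auto simp: algebra_simps)
qed

text \<open>Termwise differentiation is justified by a Weierstrass majorant for the derivative
  series, uniform on a ball around 0 that contains \<open>q\<close>.\<close>

lemma deriv_summable_has_derivative:
  fixes C :: "nat \<Rightarrow> 'a::{real_normed_algebra_1, banach}"
  assumes C: "deriv_summable C" and q: "norm q < 1"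
  shows "((\<lambda>q. \<Sum>n. q ^ n * C n) has_derivative (\<lambda>h. \<Sum>n. power_deriv n q h * C n)) (at q)"
proof -
  \<comment> \<open>The room between \<open>norm q\<close> and \<open>r\<close> makes
    \<open>ball 0 r\<close> a neighbourhood of \<open>q\<close>, while r < 1 keeps the majorant
    \<open>?M\<close> summable.\<close>
  obtain r where r: "norm q < r" "r < 1"
    using q dense by blast
  have r0: "0 < r"
    using r(1) norm_ge_zero le_less_trans by blast
  let ?M = "\<lambda>n. of_nat n * r ^ (n - 1) * norm (C n)"
  have M: "summable ?M"
    using C r r0 by (auto simp: deriv_summable_def)
  have bound: "norm (power_deriv n x h * C n) \<le> ?M n * norm h" if "x \<in> ball 0 r" for n x h
    using that mult_right_mono[OF norm_power_deriv_le[of x r n h], of "norm (C n)"]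
    by (intro order_trans[OF norm_mult_ineq]) (auto simp: algebra_simps)
  have unif: "\<forall>\<^sub>F n in sequentially. \<forall>x\<in>ball 0 r. \<forall>h.
      norm ((\<Sum>i<n. power_deriv i x h * C i) - (\<Sum>i. power_deriv i x h * C i)) \<le> e * norm h"
    if e: "e > 0" for e
  proof -
    obtain N where N: "\<And>n. n \<ge> N \<Longrightarrow> norm (\<Sum>i. ?M (i + n)) < e"
      using suminf_exist_split[OF e M] by blast
    have "norm ((\<Sum>i<n. power_deriv i x h * C i) - (\<Sum>i. power_deriv i x h * C i)) \<le> e * norm h"
      if n: "n \<ge> N" and x: "x \<in> ball 0 r" for n x h
    proof -
      have s: "summable (\<lambda>i. power_deriv i x h * C i)"
        by (rule deriv_summable_power_deriv[OF C]) (use x r in auto)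
      have M': "summable (\<lambda>i. ?M (i + n) * norm h)"
        by (intro summable_mult2 summable_ignore_initial_segment M)
      have "norm ((\<Sum>i<n. power_deriv i x h * C i) - (\<Sum>i. power_deriv i x h * C i))
          = norm (\<Sum>i. power_deriv (i + n) x h * C (i + n))"
        using suminf_split_initial_segment[OF s, of n] by (simp add: norm_minus_commute)
      also have "\<dots> \<le> (\<Sum>i. ?M (i + n) * norm h)"
        using M' bound[OF x] by (rule norm_suminf_le[rotated])
      also have "\<dots> = (\<Sum>i. ?M (i + n)) * norm h"
        by (rule suminf_mult2[symmetric, OF summable_ignore_initial_segment[OF M]])
      also have "\<dots> \<le> e * norm h"
        using N[OF n] by (intro mult_right_mono) auto
      finally show ?thesis .
    qed
    then show ?thesis
      by (intro eventually_sequentiallyI[of N]) blast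
  qed
  have "\<exists>g. \<forall>x\<in>ball 0 r. (\<lambda>n. x ^ n * C n) sums g x \<and>
      (g has_derivative (\<lambda>h. \<Sum>n. power_deriv n x h * C n)) (at x within ball 0 r)"
  proof (rule has_derivative_series)
    \<comment> \<open>The series of functions must converge at one point; at the origin only the
      constant term survives.\<close>
    have "(\<lambda>n. 0 ^ n * C n) = (\<lambda>n. if n = 0 then C n else 0)"
      by (simp add: fun_eq_iff power_0_left)
    then show "(\<lambda>n. 0 ^ n * C n) sums C 0"
      using sums_single[of 0 C] by simp
  qed (use unif r0 in \<open>auto intro!: has_derivative_mult_left has_derivative_power_noncomm\<close>)
  then obtain g where g: "\<And>x. x \<in> ball 0 r \<Longrightarrow> (\<lambda>n. x ^ n * C n) sums g x"
      "\<And>x. x \<in> ball 0 r \<Longrightarrow> (g has_derivative (\<lambda>h. \<Sum>n. power_deriv n x h * C n)) (at x within ball 0 r)"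
    by blast
  have "(g has_derivative (\<lambda>h. \<Sum>n. power_deriv n q h * C n)) (at q)"
    using g(2)[of q] r at_within_open[of q "ball 0 r"] by simp
  then show ?thesis
    by (rule has_derivative_transform_within_open[where s = "ball 0 r"])
      (use g(1) r in \<open>auto simp: sums_iff\<close>)
qed

lemma holomorphic_power_series_deriv_summable:
  assumes "h holomorphic_on ball 0 1"
  obtains c :: "nat \<Rightarrow> complex" where
    "deriv_summable c" "\<And>z. norm z < 1 \<Longrightarrow> (\<lambda>n. z ^ n * c n) sums h z"
proof -
  define c where "c n = (deriv ^^ n) h 0 / fact n" for n
  have c: "(\<lambda>n. c n * z ^ n) sums h z" if "norm z < 1" for z
    using holomorphic_power_series[OF assms, of z] that by (simp add: c_def)
  have "summable (\<lambda>n. of_nat n * r ^ (n - 1) * norm (c n))" if r: "0 \<le> r" "r < 1" for r :: real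
  proof -
    \<comment> \<open>The differentiated series converges at \<open>s\<close>, hence absolutely at
      the smaller radius \<open>r\<close>. Since \<open>diffs\<close> shifts the index by one, the
      result is first obtained for \<open>Suc n\<close>.\<close>
    obtain s where s: "r < s" "s < 1"
      using r(2) dense by blast
    have "summable (\<lambda>n. diffs c n * of_real s ^ n)"
      using c r s by (intro termdiff_converges[where K = 1]) (auto simp: sums_iff)
    then have "summable (\<lambda>n. norm (diffs c n * of_real r ^ n))"
      by (rule powser_insidea) (use r s in auto)
    then have "summable (\<lambda>n. of_nat (Suc n) * r ^ (Suc n - 1) * norm (c (Suc n)))"
      using r by (simp add: diffs_def norm_mult norm_power mult_ac del: of_nat_Suc)
    then show ?thesis
      by (simp only: summable_Suc_iff[of "\<lambda>n. of_nat n * r ^ (n - 1) * norm (c n)"])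
  qed
  then have "deriv_summable c"
    by (auto simp: deriv_summable_def)
  then show ?thesis
    using c by (intro that[of c]) (auto simp: mult.commute)
qed



section \<open>Slice regularity\<close>

lemma slice_embed_linear_eq:
  assumes "linear F'"
  shows "F' (slice_embed i z) = Re z *\<^sub>R F' 1 + Im z *\<^sub>R F' i"
proof -
  have "slice_embed i z = Re z *\<^sub>R 1 + Im z *\<^sub>R i"
    by (simp add: slice_embed_def quat_eq_iff)
  then show ?thesis
    using assms by (simp add: linear_add linear_scale)
qed

lemma has_derivative_imp_partials:
  fixes F :: "quat \<Rightarrow> quat"
  assumes "(F has_derivative F') (at (of_real x + i * of_real y))"
  shows "((\<lambda>s. F (of_real s + i * of_real y)) has_vector_derivative F' 1) (at x)"
    and "((\<lambda>t. F (of_real x + i * of_real t)) has_vector_derivative F' i) (at y)"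
proof -
  have "((\<lambda>s. of_real s + i * of_real y) has_vector_derivative 1) (at x)"
    unfolding has_vector_derivative_def
    by (auto intro!: derivative_eq_intros simp: scaleR_conv_of_real)
  from vector_derivative_diff_chain_within[OF this has_derivative_at_withinI[OF assms]]
  show "((\<lambda>s. F (of_real s + i * of_real y)) has_vector_derivative F' 1) (at x)"
    by (simp add: o_def)
  have "i * of_real t = t *\<^sub>R i" for t
    by (simp add: quat_eq_iff)
  then have "((\<lambda>t. of_real x + i * of_real t) has_vector_derivative i) (at y)"
    unfolding has_vector_derivative_def by (auto intro!: derivative_eq_intros)
  from vector_derivative_diff_chain_within[OF this has_derivative_at_withinI[OF assms]]
  show "((\<lambda>t. F (of_real x + i * of_real t)) has_vector_derivative F' i) (at y)"
    by (simp add: o_def)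
qed

lemma deriv_x0_eq:
  assumes "(F has_derivative F') (at q)"
  shows "((\<lambda>t. F (q + of_real t)) has_vector_derivative F' 1) (at 0)" "deriv_x0 F q = F' 1"
proof -
  have *: "((\<lambda>t. q + of_real t) has_vector_derivative 1) (at 0)"
    unfolding has_vector_derivative_def
    by (auto intro!: derivative_eq_intros simp: scaleR_conv_of_real)
  have "(F has_derivative F') (at (q + of_real 0) within range (\<lambda>t. q + of_real t))"
    using assms by (simp add: has_derivative_at_withinI)
  from vector_derivative_diff_chain_within[OF * this]
  show "((\<lambda>t. F (q + of_real t)) has_vector_derivative F' 1) (at 0)"
    by (simp add: o_def)
  then show "deriv_x0 F q = F' 1"
    unfolding deriv_x0_def by (rule vector_derivative_at)
qed

text \<open>The slices through \<open>q\<close> belong to the imaginary units commuting with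
  \<open>q\<close>: one pair of opposite units for non-real \<open>q\<close>, all units for real
  \<open>q\<close>. Commutation thus replaces the coordinates x and y.\<close>

lemma slice_regularI:
  assumes "\<And>q. norm q < 1 \<Longrightarrow> \<exists>F'. (F has_derivative F') (at q) \<and>
    (\<forall>i\<in>imag_sphere. i * q = q * i \<longrightarrow> F' 1 + i * F' i = 0)"
  shows "F \<in> slice_regular"
  unfolding slice_regular_def mem_Collect_eq
proof (intro conjI ballI allI impI)
  show "F differentiable_on ball 0 1"
    unfolding differentiable_on_def
  proof
    fix q :: quat
    assume "q \<in> ball 0 1"
    then have "\<exists>F'. (F has_derivative F') (at q)"
      using assms[of q] by auto
    then show "F differentiable (at q within ball 0 1)"
      using differentiableI differentiable_at_withinI by blast
  qed
next
  fix i :: quat and x y :: real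
  let ?q = "of_real x + i * of_real y"
  assume i: "i \<in> imag_sphere" and "?q \<in> ball 0 1"
  moreover have "i * ?q = ?q * i"
    by (simp add: quat_eq_iff algebra_simps)
  ultimately obtain F' where F': "(F has_derivative F') (at ?q)" "F' 1 + i * F' i = 0"
    using assms[of ?q] by auto
  show "vector_derivative (\<lambda>s. F (of_real s + i * of_real y)) (at x) +
      i * vector_derivative (\<lambda>t. F (of_real x + i * of_real t)) (at y) = 0"
    using has_derivative_imp_partials[OF F'(1)] F'(2) by (simp add: vector_derivative_at)
qed

text \<open>Multiplying the Cauchy-Riemann equation by \<open>i\<close> gives
  \<open>F' i = i * F' 1\<close>. On the slice plane the derivative is therefore left multiplication
  applied to \<open>F' 1\<close>.\<close>

lemma slice_regularD:
  assumes F: "F \<in> slice_regular" and i: "i \<in> imag_sphere" and z: "norm z < 1"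
  obtains F' where "(F has_derivative F') (at (slice_embed i z))"
    "\<And>w. F' (slice_embed i w) = slice_embed i w * F' 1"
proof -
  let ?q = "of_real (Re z) + i * of_real (Im z)"
  have q: "?q \<in> ball 0 1"
    using norm_slice_embed[OF i, of z] z by (simp add: slice_embed_def)
  with F obtain F' where F': "(F has_derivative F') (at ?q)"
    unfolding slice_regular_def differentiable_on_def differentiable_def mem_Collect_eq
    using at_within_open[OF q open_ball] by metis
  have "vector_derivative (\<lambda>s. F (of_real s + i * of_real (Im z))) (at (Re z)) +
      i * vector_derivative (\<lambda>t. F (of_real (Re z) + i * of_real t)) (at (Im z)) = 0"
    using F i q unfolding slice_regular_def by blast
  then have "F' 1 + i * F' i = 0"
    using has_derivative_imp_partials[OF F'] by (simp add: vector_derivative_at)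
  then have "i * (F' 1 + i * F' i) = 0"
    by simp
  moreover have "i * (i * F' i) = - F' i"
    using imag_sphere_square[OF i] by (simp flip: mult.assoc)
  ultimately have "F' i = i * F' 1"
    by (simp add: distrib_left)
  then have "F' (slice_embed i w) = slice_embed i w * F' 1" for w
    using slice_embed_linear_eq[OF has_derivative_linear[OF F']]
    by (simp add: slice_embed_def of_real_def distrib_right)
  then show ?thesis
    using F' by (intro that[of F']) (auto simp: slice_embed_def)
qed

text \<open>Each term satisfies the Cauchy-Riemann equation: \<open>i\<close> moves to the front of
  \<open>power_deriv\<close>, and the coefficient, standing on the right, is never crossed.\<close>

lemma power_series_slice_regular:
  assumes "deriv_summable C" "\<And>q. norm q < 1 \<Longrightarrow> (\<lambda>n. q ^ n * C n) sums F q"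
  shows "F \<in> slice_regular"
proof (rule slice_regularI)
  fix q :: quat
  assume q: "norm q < 1"
  let ?F' = "\<lambda>h. \<Sum>n. power_deriv n q h * C n"
  have "((\<lambda>q. \<Sum>n. q ^ n * C n) has_derivative ?F') (at q)"
    by (rule deriv_summable_has_derivative[OF assms(1) q])
  then have "(F has_derivative ?F') (at q)"
    by (rule has_derivative_transform_within_open[where s = "ball 0 1"])
      (use q assms(2) in \<open>auto simp: sums_iff\<close>)
  moreover have "?F' 1 + i * ?F' i = 0" if i: "i \<in> imag_sphere" "i * q = q * i" for i
  proof -
    have "i * (power_deriv n q i * C n) = - (power_deriv n q 1 * C n)" for n
    proof -
      have "i * (i * p) = - p" for p
        using imag_sphere_square[OF i(1)] by (simp flip: mult.assoc)
      then show ?thesis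
        by (simp add: power_deriv_commute[OF i(2)] mult.assoc)
    qed
    then have "i * ?F' i = (\<Sum>n. - (power_deriv n q 1 * C n))"
      using deriv_summable_power_deriv[OF assms(1) q, of i] by (simp flip: suminf_mult)
    also have "\<dots> = - ?F' 1"
      by (rule suminf_minus[OF deriv_summable_power_deriv[OF assms(1) q]])
    finally show ?thesis
      by simp
  qed
  ultimately show "\<exists>F'. (F has_derivative F') (at q) \<and>
      (\<forall>i\<in>imag_sphere. i * q = q * i \<longrightarrow> F' 1 + i * F' i = 0)"
    by blast
qed


section \<open>Splitting\<close>

text \<open>For an imaginary unit \<open>I\<close>, the orthogonal projection of \<open>p\<close> to
  the slice plane, read as a complex number.\<close>

definition slice_coord :: "quat \<Rightarrow> quat \<Rightarrow> complex" where
  "slice_coord I p = Complex (qRe p) (inner p I)"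

lemma bounded_linear_slice_coord: "bounded_linear (slice_coord I)"
proof -
  have "linear (slice_coord I)"
    by (rule linearI) (simp_all add: slice_coord_def inner_quat_def complex_eq_iff algebra_simps)
  then show ?thesis
    by (simp add: linear_conv_bounded_linear)
qed

text \<open>The map taking \<open>p\<close> to \<open>- I * p * I\<close> fixes the slice plane and
  negates its orthogonal complement, so averaging it with the identity gives the projection.\<close>

lemma slice_embed_slice_coord:
  assumes "I \<in> imag_sphere"
  shows "slice_embed I (slice_coord I p) = (p - I * p * I) /\<^sub>R 2"
proof -
  have I: "qRe I = 0" "(qIm1 I)\<^sup>2 + (qIm2 I)\<^sup>2 + (qIm3 I)\<^sup>2 = 1"
    using assms norm_quat_power2[of I] by (auto simp: imag_sphere_def)
  show ?thesis
    unfolding slice_embed_def slice_coord_def quat_eq_iff inner_quat_def using I(2)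
    by (simp add: I(1) field_simps; intro conjI; algebra)
qed

text \<open>Left multiplication by an element of the slice plane preserves both the plane and its
  orthogonal complement.\<close>

lemma slice_coord_mult:
  assumes "I \<in> imag_sphere"
  shows "slice_coord I (slice_embed I z * p) = z * slice_coord I p"
proof -
  have I: "qRe I = 0" "(qIm1 I)\<^sup>2 + (qIm2 I)\<^sup>2 + (qIm3 I)\<^sup>2 = 1"
    using assms norm_quat_power2[of I] by (auto simp: imag_sphere_def)
  show ?thesis
    unfolding slice_embed_def slice_coord_def complex_eq_iff inner_quat_def using I(2)
    by (simp add: I(1) algebra_simps) algebra
qed

text \<open>If p = p1 + p2 j, then - p j = p2 - p1 j, so p2 is the slice component of
  \<open>- (p * j)\<close>. After expanding both projections the terms \<open>I * p * I\<close>
  cancel.\<close>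

lemma slice_coord_decomposition:
  assumes I: "I \<in> imag_sphere" and j: "j \<in> imag_sphere" and "orthogonal I j"
  shows "p = slice_embed I (slice_coord I p) + slice_embed I (slice_coord I (- (p * j))) * j"
proof -
  have jj: "x * j * j = - x" for x
    using imag_sphere_square[OF j] by (simp add: mult.assoc)
  have jI: "x * j * I = - (x * I * j)" for x
    using imag_sphere_anticommute[OF assms] by (simp add: mult.assoc)
  have "I * (p * j) * I * j = I * p * I"
    using jI[of "I * p"] jj[of "I * p * I"] by (simp add: mult.assoc)
  then show ?thesis
    by (simp add: slice_embed_slice_coord[OF I] left_diff_distrib distrib_right jj)
      (simp add: quat_eq_iff field_simps)
qed

text \<open>The derivative is complex linear because \<open>slice_coord\<close> commutes with left
  multiplication from the slice. The right factor \<open>c\<close> covers both components of the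
  splitting, with \<open>c\<close> equal to 1 and to \<open>- j\<close>.\<close>

lemma slice_coord_holomorphic:
  assumes F: "F \<in> slice_regular" and I: "I \<in> imag_sphere"
  shows "(\<lambda>z. slice_coord I (F (slice_embed I z) * c)) holomorphic_on ball 0 1"
  unfolding holomorphic_on_def
proof
  fix z :: complex
  assume "z \<in> ball 0 1"
  then obtain F' where F': "(F has_derivative F') (at (slice_embed I z))"
    "\<And>w. F' (slice_embed I w) = slice_embed I w * F' 1"
    using slice_regularD[OF F I, of z] by auto
  have "((\<lambda>z. F (slice_embed I z)) has_derivative (\<lambda>w. F' (slice_embed I w))) (at z)"
    by (rule has_derivative_compose[OF bounded_linear_imp_has_derivative[OF bounded_linear_slice_embed[OF I]] F'(1)])
  then have "((\<lambda>z. slice_coord I (F (slice_embed I z) * c)) has_derivative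
      (\<lambda>w. slice_coord I (F' (slice_embed I w) * c))) (at z)"
    by (intro bounded_linear.has_derivative[OF bounded_linear_slice_coord] has_derivative_mult_left)
  then have "((\<lambda>z. slice_coord I (F (slice_embed I z) * c)) has_field_derivative
      slice_coord I (F' 1 * c)) (at z)"
    unfolding has_field_derivative_def
    by (rule has_derivative_eq_rhs)
      (simp add: F'(2) mult.assoc slice_coord_mult[OF I] mult.commute[of _ "slice_coord I _"] fun_eq_iff)
  then show "(\<lambda>z. slice_coord I (F (slice_embed I z) * c)) field_differentiable at z within ball 0 1"
    using field_differentiable_at_within field_differentiable_def by blast
qed

lemma slice_splitting_exists:
  assumes F: "F \<in> slice_regular"
    and I: "I \<in> imag_sphere" and j: "j \<in> imag_sphere" "orthogonal I j"
  shows "slice_splitting I j F (\<lambda>q. slice_embed I (slice_coord I (F q)))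
    (\<lambda>q. slice_embed I (slice_coord I (- (F q * j))))"
  unfolding slice_splitting_def slice_holomorphic_def
proof (intro conjI ballI)
  show "\<exists>h. h holomorphic_on ball 0 1 \<and> (\<forall>z\<in>ball 0 1.
      slice_embed I (slice_coord I (F (slice_embed I z))) = slice_embed I (h z))"
    using slice_coord_holomorphic[OF F I, of 1] by auto
  show "\<exists>h. h holomorphic_on ball 0 1 \<and> (\<forall>z\<in>ball 0 1.
      slice_embed I (slice_coord I (- (F (slice_embed I z) * j))) = slice_embed I (h z))"
    using slice_coord_holomorphic[OF F I, of "- j"] by auto
  show "slice_restrict I F z = slice_embed I (slice_coord I (F z)) +
      slice_embed I (slice_coord I (- (F z * j))) * j" if "z \<in> slice_ball I" for z
    using slice_coord_decomposition[OF I j, of "F z"] that by (simp add: slice_restrict_def)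
qed


section \<open>The extension operator\<close>

lemma slice_extend_embed:
  assumes "J \<in> imag_sphere"
  shows "slice_extend I g (slice_embed J z) =
    ((1 + J * I) * g (slice_embed I (cnj z)) + (1 - J * I) * g (slice_embed I z)) /\<^sub>R 2"
proof -
  have "of_real y * I = I * of_real y" for y
    by (simp add: quat_eq_iff)
  then show ?thesis
    using slice_extend_eq[OF assms, of I g "Re z" "Im z"] by (simp add: slice_embed_def)
qed

lemma slice_extend_same_slice:
  assumes "I \<in> imag_sphere"
  shows "slice_extend I g (slice_embed I z) = g (slice_embed I z)"
  by (simp add: slice_extend_embed[OF assms] imag_sphere_square[OF assms])

text \<open>Taken at \<open>w = z ^ n\<close>, this is the representation formula for monomials: it
  recovers the power on the slice of \<open>J\<close> from two conjugate points on the slice of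
  \<open>I\<close>.\<close>

lemma slice_embed_representation:
  assumes "I \<in> imag_sphere"
  shows "slice_embed J w =
    ((1 + J * I) * slice_embed I (cnj w) + (1 - J * I) * slice_embed I w) /\<^sub>R 2"
proof -
  have "J * (I * (I * x)) = - (J * x)" for x
    using imag_sphere_square[OF assms] by (simp flip: mult.assoc)
  then show ?thesis
    by (simp add: slice_embed_def algebra_simps) (simp add: quat_eq_iff)
qed

text \<open>The extension keeps the coefficients of the series on the slice of \<open>I\<close>.
  They stand on the right, so the representation formula for powers applies term by term.\<close>

lemma slice_extend_power_series:
  assumes I: "I \<in> imag_sphere"
    and g: "\<And>z. norm z < 1 \<Longrightarrow> g (slice_embed I z) = slice_embed I (h z)"
    and h: "\<And>z. norm z < 1 \<Longrightarrow> (\<lambda>n. z ^ n * c n) sums h z"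
    and q: "norm q < 1"
  shows "(\<lambda>n. q ^ n * slice_embed I (c n)) sums slice_extend I g q"
proof -
  obtain J z where J: "J \<in> imag_sphere" and qz: "q = slice_embed J z"
    using quat_in_slice_plane .
  have z: "norm z < 1"
    using q J by (simp add: qz norm_slice_embed)
  have *: "(\<lambda>n. slice_embed I (w ^ n) * slice_embed I (c n)) sums g (slice_embed I w)"
    if "norm w < 1" for w
    using bounded_linear.sums[OF bounded_linear_slice_embed[OF I] h[OF that]]
    by (simp add: g[OF that] slice_embed_mult[OF I])
  have "(\<lambda>n. ((1 + J * I) * (slice_embed I (cnj z ^ n) * slice_embed I (c n)) +
      (1 - J * I) * (slice_embed I (z ^ n) * slice_embed I (c n))) /\<^sub>R 2) sums slice_extend I g q"
    unfolding qz slice_extend_embed[OF J]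
    by (intro sums_scaleR_right sums_add sums_mult *) (use z in auto)
  moreover have "((1 + J * I) * (slice_embed I (cnj z ^ n) * slice_embed I (c n)) +
      (1 - J * I) * (slice_embed I (z ^ n) * slice_embed I (c n))) /\<^sub>R 2 = q ^ n * slice_embed I (c n)" for n
    unfolding qz slice_embed_power[OF J, symmetric] slice_embed_representation[OF I, of J "z ^ n"]
    by (simp add: distrib_right mult.assoc)
  ultimately show ?thesis
    by simp
qed

lemma slice_extend_slice_regular:
  assumes I: "I \<in> imag_sphere" and g: "slice_holomorphic I g1" "slice_holomorphic I g2"
  shows "(\<lambda>q. slice_extend I g1 q + slice_extend I g2 q * j) \<in> slice_regular"
proof -
  obtain h1 h2 where h: "h1 holomorphic_on ball 0 1" "h2 holomorphic_on ball 0 1"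
    and g1: "\<And>z. norm z < 1 \<Longrightarrow> g1 (slice_embed I z) = slice_embed I (h1 z)"
    and g2: "\<And>z. norm z < 1 \<Longrightarrow> g2 (slice_embed I z) = slice_embed I (h2 z)"
    using g unfolding slice_holomorphic_def Ball_def mem_ball_0 by blast
  obtain c1 where c1: "deriv_summable c1" "\<And>z. norm z < 1 \<Longrightarrow> (\<lambda>n. z ^ n * c1 n) sums h1 z"
    using holomorphic_power_series_deriv_summable[OF h(1)] by blast
  obtain c2 where c2: "deriv_summable c2" "\<And>z. norm z < 1 \<Longrightarrow> (\<lambda>n. z ^ n * c2 n) sums h2 z"
    using holomorphic_power_series_deriv_summable[OF h(2)] by blast
  \<comment> \<open>The factor \<open>j\<close> also stands on the right, so both series merge into
    one with quaternionic coefficients.\<close>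
  define C where "C n = slice_embed I (c1 n) + slice_embed I (c2 n) * j" for n
  have "summable (\<lambda>n. of_nat n * r ^ (n - 1) * norm (C n))" if r: "0 \<le> r" "r < 1" for r :: real
  proof (rule summable_comparison_test')
    show "summable (\<lambda>n. of_nat n * r ^ (n - 1) * norm (c1 n) + of_nat n * r ^ (n - 1) * norm (c2 n) * norm j)"
      using c1(1) c2(1) r by (intro summable_add summable_mult2) (auto simp: deriv_summable_def)
    fix n :: nat
    have "norm (C n) \<le> norm (c1 n) + norm (c2 n) * norm j"
      unfolding C_def by (rule norm_triangle_le) (simp add: norm_mult norm_slice_embed[OF I])
    then have "of_nat n * r ^ (n - 1) * norm (C n) \<le> of_nat n * r ^ (n - 1) * (norm (c1 n) + norm (c2 n) * norm j)"
      using r by (intro mult_left_mono) auto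
    then show "norm (of_nat n * r ^ (n - 1) * norm (C n)) \<le>
        of_nat n * r ^ (n - 1) * norm (c1 n) + of_nat n * r ^ (n - 1) * norm (c2 n) * norm j"
      using r by (simp add: algebra_simps)
  qed
  then have C: "deriv_summable C"
    by (auto simp: deriv_summable_def)
  show ?thesis
  proof (rule power_series_slice_regular[OF C])
    fix q :: quat
    assume q: "norm q < 1"
    have "(\<lambda>n. q ^ n * slice_embed I (c1 n) + q ^ n * slice_embed I (c2 n) * j) sums
        (slice_extend I g1 q + slice_extend I g2 q * j)"
      by (intro sums_add sums_mult2 slice_extend_power_series[OF I _ _ q])
        (use g1 g2 c1 c2 in auto)
    then show "(\<lambda>n. q ^ n * C n) sums (slice_extend I g1 q + slice_extend I g2 q * j)"
      by (simp add: C_def distrib_left mult.assoc)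
  qed
qed

text \<open>Differentiating the representation formula in \<open>x\<^sub>0\<close> bounds the derivative on every slice by
  its values on a single one, at the cost of a factor 2.\<close>

lemma slice_bloch_from_slice:
  assumes I: "I \<in> imag_sphere" and F: "F \<in> slice_regular"
    and rep: "\<And>q. F q = slice_extend I F q"
    and bound: "\<And>z. norm z < 1 \<Longrightarrow> (1 - (norm z)\<^sup>2) * norm (deriv_x0 F (slice_embed I z)) \<le> M"
  shows "F \<in> slice_bloch"
proof -
  have "(1 - (norm q)\<^sup>2) * norm (deriv_x0 F q) \<le> 2 * M" if q: "norm q < 1" for q
  proof -
    obtain J z where J: "J \<in> imag_sphere" and qz: "q = slice_embed J z"
      using quat_in_slice_plane .
    have z: "norm z < 1" and nz: "norm q = norm z"
      using q J by (simp_all add: qz norm_slice_embed)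
    have *: "((\<lambda>t. F (slice_embed I w + of_real t)) has_vector_derivative
        deriv_x0 F (slice_embed I w)) (at 0)" if w: "norm w < 1" for w
    proof -
      obtain F' where "(F has_derivative F') (at (slice_embed I w))"
        using slice_regularD[OF F I w] by blast
      from deriv_x0_eq[OF this] show ?thesis
        by simp
    qed
    let ?A = "deriv_x0 F (slice_embed I (cnj z))" and ?B = "deriv_x0 F (slice_embed I z)"
    \<comment> \<open>A real translation stays within the slice and moves \<open>z\<close> and
      \<open>cnj z\<close> alike, so the representation formula can be differentiated along
      it.\<close>
    have shift: "slice_embed K w + of_real t = slice_embed K (w + of_real t)" for K w t
      by (simp add: slice_embed_add)
    have "F (q + of_real t) = ((1 + J * I) * F (slice_embed I (cnj z) + of_real t) +
        (1 - J * I) * F (slice_embed I z + of_real t)) /\<^sub>R 2" for t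
      by (subst rep) (simp add: qz shift slice_extend_embed[OF J])
    moreover have "((\<lambda>t. ((1 + J * I) * F (slice_embed I (cnj z) + of_real t) +
        (1 - J * I) * F (slice_embed I z + of_real t)) /\<^sub>R 2) has_vector_derivative
        ((1 + J * I) * ?A + (1 - J * I) * ?B) /\<^sub>R 2) (at 0)"
      by (intro bounded_linear.has_vector_derivative[OF bounded_linear_scaleR_right]
          has_vector_derivative_add has_vector_derivative_mult_right *) (use z in auto)
    ultimately have D: "deriv_x0 F q = ((1 + J * I) * ?A + (1 - J * I) * ?B) /\<^sub>R 2"
      unfolding deriv_x0_def[of F q] by (intro vector_derivative_at) simp
    have JI: "norm (J * I) = 1"
      using I J by (simp add: imag_sphere_def norm_mult)
    \<comment> \<open>These factors 2 cancel against the halving in \<open>D\<close>. The final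
      \<open>2 * M\<close> comes from the two points \<open>z\<close> and \<open>cnj z\<close>,
      which have equal norm.\<close>
    have "norm (1 + J * I) \<le> 2" "norm (1 - J * I) \<le> 2"
      using norm_triangle_ineq[of 1 "J * I"] norm_triangle_ineq4[of 1 "J * I"] JI by auto
    then have "norm ((1 + J * I) * ?A) \<le> 2 * norm ?A" "norm ((1 - J * I) * ?B) \<le> 2 * norm ?B"
      by (simp_all add: norm_mult mult_right_mono)
    then have "norm (deriv_x0 F q) \<le> norm ?A + norm ?B"
      unfolding D using norm_triangle_ineq[of "(1 + J * I) * ?A" "(1 - J * I) * ?B"] by simp
    then have "(1 - (norm q)\<^sup>2) * norm (deriv_x0 F q) \<le> (1 - (norm z)\<^sup>2) * (norm ?A + norm ?B)"
      using z unfolding nz by (intro mult_left_mono) (auto simp: power_le_one)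
    also have "\<dots> \<le> 2 * M"
      using bound[of z] bound[of "cnj z"] z by (simp add: distrib_left)
    finally show ?thesis .
  qed
  then show ?thesis
    unfolding slice_bloch_def using F by (auto intro!: bdd_aboveI[of _ "2 * M"])
qed


section \<open>Moebius transformations\<close>

lemma qcnj_slice_embed:
  assumes "I \<in> imag_sphere"
  shows "qcnj (slice_embed I z) = slice_embed I (cnj z)"
  using assms by (simp add: slice_embed_def quat_eq_iff imag_sphere_def)

lemma moebius_denominator_nonzero:
  fixes \<alpha> z :: complex
  assumes "norm \<alpha> < 1" "norm z < 1"
  shows "1 - cnj \<alpha> * z \<noteq> 0"
proof
  assume "1 - cnj \<alpha> * z = 0"
  then have "norm (cnj \<alpha> * z) = 1"
    by (metis eq_iff_diff_eq_0 norm_one)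
  moreover have "norm \<alpha> * norm z < 1 * 1"
    using assms by (intro mult_strict_mono') auto
  ultimately show False
    by (simp add: norm_mult)
qed

text \<open>On a slice containing the parameter all coefficients lie in that commutative plane, so
  the star product becomes the ordinary product of a geometric series with \<alpha> - z.\<close>

lemma slice_moebius_slice_embed:
  assumes I: "I \<in> imag_sphere" and \<alpha>: "norm \<alpha> < 1" and z: "norm z < 1"
  shows "slice_moebius (slice_embed I \<alpha>) (slice_embed I z) = slice_embed I ((\<alpha> - z) / (1 - cnj \<alpha> * z))"
proof -
  \<comment> \<open>The Cauchy product coefficients. The factor - z shifts the geometric series by
    one place, so nothing is subtracted at n = 0.\<close>
  define c where "c n = cnj \<alpha> ^ n * \<alpha> - (if n = 0 then 0 else cnj \<alpha> ^ (n - 1))" for n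
  have lt: "norm (cnj \<alpha> * z) < 1"
    using \<alpha> z mult_strict_mono'[of "norm \<alpha>" 1 "norm z" 1] by (simp add: norm_mult)
  have geo: "(\<lambda>n. (cnj \<alpha> * z) ^ n) sums (1 / (1 - cnj \<alpha> * z))"
    using geometric_sums[OF lt] .
  have "(\<lambda>n. if n = 0 then 0 else z * (cnj \<alpha> * z) ^ (n - 1)) sums (z * (1 / (1 - cnj \<alpha> * z)))"
    by (rule sums_Suc_imp[rotated]) (use sums_mult[OF geo, of z] in auto)
  from sums_diff[OF sums_mult[OF geo, of \<alpha>] this]
  have "(\<lambda>n. \<alpha> * (cnj \<alpha> * z) ^ n - (if n = 0 then 0 else z * (cnj \<alpha> * z) ^ (n - 1))) sums
      ((\<alpha> - z) / (1 - cnj \<alpha> * z))"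
    by (simp add: diff_divide_distrib)
  moreover have "\<alpha> * (cnj \<alpha> * z) ^ n - (if n = 0 then 0 else z * (cnj \<alpha> * z) ^ (n - 1)) = z ^ n * c n" for n
    by (cases n) (simp_all add: c_def power_mult_distrib algebra_simps)
  ultimately have "(\<lambda>n. z ^ n * c n) sums ((\<alpha> - z) / (1 - cnj \<alpha> * z))"
    by simp
  from bounded_linear.sums[OF bounded_linear_slice_embed[OF I] this]
  have *: "(\<lambda>n. slice_embed I z ^ n * slice_embed I (c n)) sums
      slice_embed I ((\<alpha> - z) / (1 - cnj \<alpha> * z))"
    by (simp add: slice_embed_mult[OF I] slice_embed_power[OF I])
  have emb_diff: "slice_embed I (u - v) = slice_embed I u - slice_embed I v" for u v
    by (simp add: slice_embed_def algebra_simps)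
  have "fps_nth (Abs_fps (\<lambda>n. qcnj (slice_embed I \<alpha>) ^ n) * (fps_const (slice_embed I \<alpha>) - fps_X)) n =
      slice_embed I (c n)" for n
    by (cases n) (simp_all add: c_def right_diff_distrib fps_mult_right_const_nth fps_X_mult_right_nth
        qcnj_slice_embed[OF I] slice_embed_mult[OF I] slice_embed_power[OF I] emb_diff)
  then show ?thesis
    using * by (simp add: slice_moebius_def slice_eval_def sums_iff)
qed

text \<open>All rests on the identity \<open>id\<close>, which factors |1 - cnj \<alpha> z|^2 -
  |\<alpha> - z|^2 as (1 - |\<alpha>|^2)(1 - |z|^2); dividing by the squared denominator gives
  equality in the Schwarz-Pick lemma.\<close>

lemma moebius_schwarz_pick:
  fixes \<alpha> z :: complex
  assumes \<alpha>: "norm \<alpha> < 1" and z: "norm z < 1"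
  defines "w \<equiv> (\<alpha> - z) / (1 - cnj \<alpha> * z)" and "d \<equiv> ((norm \<alpha>)\<^sup>2 - 1) / (1 - cnj \<alpha> * z)\<^sup>2"
  shows "(1 - (norm z)\<^sup>2) * norm d = 1 - (norm w)\<^sup>2" and "norm w < 1"
    and "((\<lambda>z. (\<alpha> - z) / (1 - cnj \<alpha> * z)) has_field_derivative d) (at z)"
proof -
  let ?D = "1 - cnj \<alpha> * z"
  have D: "?D \<noteq> 0"
    by (rule moebius_denominator_nonzero[OF \<alpha> z])
  have id: "(norm ?D)\<^sup>2 - (norm (\<alpha> - z))\<^sup>2 = (1 - (norm \<alpha>)\<^sup>2) * (1 - (norm z)\<^sup>2)"
    unfolding cmod_power2 by (simp add: algebra_simps power2_eq_square)
  have pos: "0 < 1 - (norm \<alpha>)\<^sup>2" "0 < 1 - (norm z)\<^sup>2"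
    using \<alpha> z by (simp_all add: power_less_one_iff)
  have "norm ((complex_of_real (norm \<alpha>))\<^sup>2 - 1) = \<bar>(norm \<alpha>)\<^sup>2 - 1\<bar>"
    by (metis norm_of_real of_real_1 of_real_diff of_real_power)
  then have "norm d = (1 - (norm \<alpha>)\<^sup>2) / (norm ?D)\<^sup>2"
    using pos(1) by (simp add: d_def norm_divide norm_power)
  moreover have "1 - (norm w)\<^sup>2 = ((norm ?D)\<^sup>2 - (norm (\<alpha> - z))\<^sup>2) / (norm ?D)\<^sup>2"
    using D by (simp add: w_def norm_divide power_divide field_simps)
  ultimately show eq: "(1 - (norm z)\<^sup>2) * norm d = 1 - (norm w)\<^sup>2"
    unfolding id by simp
  \<comment> \<open>By \<open>eq\<close>, a nonvanishing derivative forces 1 - |w|^2 to be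
    positive.\<close>
  have "norm d > 0"
    using pos D \<open>norm d = _\<close> by simp
  then have "1 - (norm w)\<^sup>2 > 0"
    using pos by (simp flip: eq)
  then show "norm w < 1"
    by (simp add: power_less_one_iff)
  \<comment> \<open>In the quotient rule the terms in z cancel, leaving cnj \<alpha> \<alpha> - 1 as
    numerator.\<close>
  have "d = (- 1 * ?D - (\<alpha> - z) * (- cnj \<alpha>)) / (?D * ?D)"
    using complex_norm_square[of \<alpha>] by (simp add: d_def power2_eq_square algebra_simps)
  moreover have "((\<lambda>z. (\<alpha> - z) / (1 - cnj \<alpha> * z)) has_field_derivative
      (- 1 * ?D - (\<alpha> - z) * (- cnj \<alpha>)) / (?D * ?D)) (at z)"
    using D by (intro DERIV_divide) (auto intro!: derivative_eq_intros)
  ultimately show "((\<lambda>z. (\<alpha> - z) / (1 - cnj \<alpha> * z)) has_field_derivative d) (at z)"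
    by simp
qed

section \<open>The Bloch estimate for composition with a Moebius map\<close>

theorem proposition2p17:
  fixes a I j :: quat and f :: "quat \<Rightarrow> quat"
  assumes "a \<in> ball 0 1"
    and "(a \<notin> \<real> \<and> I = qvec a /\<^sub>R norm (qvec a)) \<or> (a \<in> \<real> \<and> I \<in> imag_sphere)"
    and "j \<in> imag_sphere" and "orthogonal I j"
    and "f \<in> slice_bloch"
  shows "slice_compose I j f (slice_moebius a) \<in> slice_bloch"
proof -
  \<comment> \<open>Both alternatives place \<open>a\<close> in the slice plane of \<open>I\<close>,
    where the Moebius map is classical.\<close>
  have "I \<in> imag_sphere \<and> (\<exists>\<alpha>. a = slice_embed I \<alpha>)"
  proof (cases "a \<in> \<real>")
    case True
    then obtain x where "a = of_real x"
      by (auto elim: Reals_cases)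
    then have "a = slice_embed I (of_real x)"
      by simp
    then show ?thesis
      using True assms(2) by blast
  next
    case False
    then have nz: "qvec a \<noteq> 0"
      by (metis Reals_of_real eq_iff_diff_eq_0 qvec_def)
    have I: "I = qvec a /\<^sub>R norm (qvec a)"
      using False assms(2) by blast
    have "a = slice_embed I (Complex (qRe a) (norm (qvec a)))"
      unfolding I using nz by (simp add: slice_embed_def quat_eq_iff)
    moreover have "I \<in> imag_sphere"
      unfolding I using nz by (simp add: imag_sphere_def)
    ultimately show ?thesis
      by blast
  qed
  then obtain \<alpha> where I: "I \<in> imag_sphere" and a: "a = slice_embed I \<alpha>"
    by blast
  have \<alpha>: "norm \<alpha> < 1"
    using assms(1) by (simp add: a norm_slice_embed[OF I])
  define \<phi> where "\<phi> z = (\<alpha> - z) / (1 - cnj \<alpha> * z)" for z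
  define \<phi>' where "\<phi>' z = ((norm \<alpha>)\<^sup>2 - 1) / (1 - cnj \<alpha> * z)\<^sup>2" for z
  note sp = moebius_schwarz_pick[OF \<alpha>, folded \<phi>_def \<phi>'_def]
  have T: "slice_restrict I (slice_moebius a) (slice_embed I z) = slice_embed I (\<phi> z)"
    if "norm z < 1" for z
    using slice_moebius_slice_embed[OF I \<alpha> that] slice_embed_in_slice_ball[OF I that]
    by (simp add: slice_restrict_def a \<phi>_def)
  have f: "f \<in> slice_regular"
    and "bdd_above ((\<lambda>q. (1 - (norm q)\<^sup>2) * norm (deriv_x0 f q)) ` ball 0 1)"
    using assms(5) by (simp_all add: slice_bloch_def)
  then obtain M where M: "\<And>q. norm q < 1 \<Longrightarrow> (1 - (norm q)\<^sup>2) * norm (deriv_x0 f q) \<le> M"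
    unfolding bdd_above_def by (metis imageI mem_ball_0)
  obtain f1 f2 where sel: "(SOME (f1, f2). slice_splitting I j f f1 f2) = (f1, f2)"
    by force
  \<comment> \<open>Existence of a splitting ensures that the pair picked by \<open>SOME\<close>
    really splits \<open>f\<close>.\<close>
  have "\<exists>p. case p of (f1, f2) \<Rightarrow> slice_splitting I j f f1 f2"
    using slice_splitting_exists[OF f I assms(3,4)] by blast
  from someI_ex[OF this] have split: "slice_splitting I j f f1 f2"
    by (simp add: sel)
  define g1 g2 where "g1 = f1 \<circ> slice_restrict I (slice_moebius a)"
    and "g2 = f2 \<circ> slice_restrict I (slice_moebius a)"
  define F where "F = slice_compose I j f (slice_moebius a)"
  have F_eq: "F q = slice_extend I g1 q + slice_extend I g2 q * j" for q
    by (simp add: F_def slice_compose_def sel g1_def g2_def)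
  have hol_comp: "slice_holomorphic I (k \<circ> slice_restrict I (slice_moebius a))"
    if k: "slice_holomorphic I k" for k
  proof -
    obtain h where h: "h holomorphic_on ball 0 1"
      "\<And>z. norm z < 1 \<Longrightarrow> k (slice_embed I z) = slice_embed I (h z)"
      using k unfolding slice_holomorphic_def Ball_def mem_ball_0 by blast
    have "\<phi> holomorphic_on ball 0 1"
      by (rule holomorphic_onI) (use sp(3) in \<open>auto intro: has_field_derivative_at_within simp: field_differentiable_def\<close>)
    then have "h \<circ> \<phi> holomorphic_on ball 0 1"
      by (rule holomorphic_on_compose_gen[OF _ h(1)]) (use sp(2) in auto)
    then show ?thesis
      unfolding slice_holomorphic_def using h(2) sp(2) T by (intro exI[of _ "h \<circ> \<phi>"]) auto
  qed
  have "slice_holomorphic I g1" "slice_holomorphic I g2"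
    unfolding g1_def g2_def using split by (auto intro!: hol_comp simp: slice_splitting_def)
  then have F: "F \<in> slice_regular"
    using slice_extend_slice_regular[OF I, of g1 g2 j] by (simp add: F_eq[abs_def])
  \<comment> \<open>On the slice of \<open>I\<close> the function \<open>F\<close> restricts to
    \<open>g1 + g2 * j\<close>; extension is compatible with right multiplication by
    \<open>j\<close>, so extending \<open>F\<close> again returns \<open>F\<close>.\<close>
  have rep: "F q = slice_extend I F q" for q
  proof -
    obtain J z where J: "J \<in> imag_sphere" and q: "q = slice_embed J z"
      using quat_in_slice_plane .
    have "F (slice_embed I w) = g1 (slice_embed I w) + g2 (slice_embed I w) * j" for w
      by (simp add: F_eq slice_extend_same_slice[OF I])
    then show ?thesis
      by (simp add: q F_eq[of "slice_embed J z"] slice_extend_embed[OF J] algebra_simps)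
  qed
  have F_slice: "F (slice_embed I z) = f (slice_embed I (\<phi> z))" if "norm z < 1" for z
  proof -
    have in_ball: "slice_embed I (\<phi> z) \<in> slice_ball I"
      by (rule slice_embed_in_slice_ball[OF I sp(2)[OF that]])
    then have "f (slice_embed I (\<phi> z)) = f1 (slice_embed I (\<phi> z)) + f2 (slice_embed I (\<phi> z)) * j"
      using split unfolding slice_splitting_def slice_restrict_def by (metis restrict_apply')
    then show ?thesis
      by (simp add: F_eq slice_extend_same_slice[OF I] g1_def g2_def T[OF that])
  qed
  have "(1 - (norm z)\<^sup>2) * norm (deriv_x0 F (slice_embed I z)) \<le> M" if z: "norm z < 1" for z
  proof -
    obtain f' where f': "(f has_derivative f') (at (slice_embed I (\<phi> z)))"
      "\<And>w. f' (slice_embed I w) = slice_embed I w * f' 1"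
      using slice_regularD[OF f I sp(2)[OF z]] by blast
    obtain F' where F': "(F has_derivative F') (at (slice_embed I z))"
      using slice_regularD[OF F I z] by blast
    \<comment> \<open>The derivative of \<open>F\<close> along the slice is computed twice, through
      f after \<phi> and directly through \<open>F'\<close>. Uniqueness, evaluated at 1, expresses
      \<open>F' 1\<close> by \<open>f' 1\<close>.\<close>
    have "((\<lambda>w. slice_embed I (\<phi> w)) has_derivative (\<lambda>v. slice_embed I (\<phi>' z * v))) (at z)"
      using sp(3)[OF z] unfolding has_field_derivative_def
      by (rule bounded_linear.has_derivative[OF bounded_linear_slice_embed[OF I]])
    from has_derivative_compose[OF this f'(1)]
    have "((\<lambda>w. f (slice_embed I (\<phi> w))) has_derivative (\<lambda>v. f' (slice_embed I (\<phi>' z * v)))) (at z)" .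
    then have "((\<lambda>w. F (slice_embed I w)) has_derivative (\<lambda>v. f' (slice_embed I (\<phi>' z * v)))) (at z)"
      by (rule has_derivative_transform_within_open[where s = "ball 0 1"]) (use z F_slice in auto)
    moreover have "((\<lambda>w. F (slice_embed I w)) has_derivative (\<lambda>v. F' (slice_embed I v))) (at z)"
      by (rule has_derivative_compose[OF bounded_linear_imp_has_derivative[OF bounded_linear_slice_embed[OF I]] F'])
    ultimately have "(\<lambda>v. f' (slice_embed I (\<phi>' z * v))) = (\<lambda>v. F' (slice_embed I v))"
      by (rule has_derivative_unique)
    from fun_cong[OF this, of 1] have "F' 1 = slice_embed I (\<phi>' z) * f' 1"
      by (simp add: f'(2))
    then have "norm (deriv_x0 F (slice_embed I z)) = norm (\<phi>' z) * norm (deriv_x0 f (slice_embed I (\<phi> z)))"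
      by (simp add: deriv_x0_eq(2)[OF F'] deriv_x0_eq(2)[OF f'(1)] norm_mult norm_slice_embed[OF I])
    \<comment> \<open>The Schwarz-Pick equality turns the weight at z times |\<phi>' z| into the
      weight at \<phi> z, so the Bloch constant of \<open>f\<close> applies there.\<close>
    then have "(1 - (norm z)\<^sup>2) * norm (deriv_x0 F (slice_embed I z)) =
        (1 - (norm (\<phi> z))\<^sup>2) * norm (deriv_x0 f (slice_embed I (\<phi> z)))"
      using sp(1)[OF z] by (simp flip: mult.assoc)
    also have "\<dots> \<le> M"
      using M[of "slice_embed I (\<phi> z)"] sp(2)[OF z] by (simp add: norm_slice_embed[OF I])
    finally show ?thesis .
  qed
  from slice_bloch_from_slice[OF I F rep this] show ?thesis
    by (simp add: F_def)
qed

end
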